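(* Let $T=\begin{pmatrix} a & b\\ -\overline{b} & \overline{a}\end{pmatrix}$ be a special unitary $2\times 2$ matrix (so $a,b\in\mathbb{C}$, $|a|^2+|b|^2=1$) with $ab\neq 0$, let $s=|a|$, $\alpha=a/|a|$, $\varphi_s(\theta)=\arccos(s\cos\theta)$, and let $D(T)=\sum_{y\in\mathbb{Z}}\mathcal{D}_T(y)\tau^y$ be the bounded self-adjoint operator on $\ell^2(\mathbb{Z},\mathbb{C}^2)$ defined in the context. Then $$D(T)^2=\sum_{y\in\mathbb{Z}}\alpha^y\,\mathcal{F}(\varphi_s^2)(y)\,I_2\,\tau^y,$$ where $I_2$ is the $2\times 2$ identity matrix and $\mathcal{F}(k)(x)=\frac{1}{2\pi}\int_0^{2\pi}e^{-ix\theta}k(\theta)\,d\theta$ for $x\in\mathbb{Z}$.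
   Context: $\ell^2(\mathbb{Z},\mathbb{C}^2)$ is the Hilbert space of square summable $\mathbb{C}^2$-valued functions on $\mathbb{Z}$. The shift operator $\tau$ is $(\tau f)(x)=f(x-1)$. $2\times 2$ matrices act pointwise on $\ell^2(\mathbb{Z},\mathbb{C}^2)$. $\arccos$ is the principal value in $[0,\pi]$. Set $s=|a|$, $r=|b|$, $\alpha=a/|a|$, $\beta=b/|b|$. For $x\in\mathbb{Z}$ define $$I(x)=\frac{1}{2\pi}\int_0^{2\pi}e^{-ix\theta}\sin\theta\,\frac{\varphi_s(\theta)}{\sin\varphi_s(\theta)}\,d\theta,\qquad J(x)=\frac{1}{2\pi}\int_0^{2\pi}e^{-ix\theta}\frac{\varphi_s(\theta)}{\sin\varphi_s(\theta)}\,d\theta,$$ and $$\mathcal{D}_T(x)=\begin{pmatrix} s\alpha^x I(x) & -ir\alpha^{x+1}\beta J(x+1)\\ ir\alpha^{x-1}\beta^{-1}J(x-1) & -s\alpha^x I(x)\end{pmatrix}.$$ The operator $D(T)=\sum_{y\in\mathbb{Z}}\mathcal{D}_T(y)\tau^y$ is a bounded self-adjoint operator on $\ell^2(\mathbb{Z},\mathbb{C}^2)$. *)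

theory Defs
  imports "HOL-Analysis.Analysis"
begin

section \<open>The Hilbert space of square summable functions from the integers to \<open>complex^2\<close>\<close>

typedef l2 = "{f :: int \<Rightarrow> complex^2. (\<lambda>x. (norm (f x))\<^sup>2) summable_on UNIV}"
  morphisms l2_apply Abs_l2
  by (rule exI[of _ "\<lambda>_. 0"]) simp

setup_lifting type_definition_l2

lemma l2_eqI: "(\<And>x. l2_apply f x = l2_apply g x) \<Longrightarrow> f = g"
  by (metis l2_apply_inject ext)

lemma l2_summable: "(\<lambda>x. (norm (l2_apply f x))\<^sup>2) summable_on UNIV"
  using l2_apply by auto

lemma norm_add_square_le: "(norm (u + v))\<^sup>2 \<le> 2 * (norm u)\<^sup>2 + 2 * (norm v)\<^sup>2"
  for u v :: "'a::real_normed_vector"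
proof -
  have "(norm (u + v))\<^sup>2 \<le> (norm u + norm v)\<^sup>2"
    by (intro power_mono norm_triangle_ineq norm_ge_zero)
  also have "\<dots> \<le> 2 * (norm u)\<^sup>2 + 2 * (norm v)\<^sup>2"
    using sum_squares_bound[of "norm u" "norm v"] by (simp add: power2_sum)
  finally show ?thesis .
qed

lemma square_summable_add:
  fixes f g :: "'i \<Rightarrow> 'a::real_normed_vector"
  assumes "(\<lambda>x. (norm (f x))\<^sup>2) summable_on A" "(\<lambda>x. (norm (g x))\<^sup>2) summable_on A"
  shows "(\<lambda>x. (norm (f x + g x))\<^sup>2) summable_on A"
proof (rule summable_on_comparison_test)
  show "(\<lambda>x. 2 * (norm (f x))\<^sup>2 + 2 * (norm (g x))\<^sup>2) summable_on A"
    by (intro summable_on_add summable_on_cmult_right assms)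
qed (use norm_add_square_le in auto)

lemma square_summable_scaleR:
  fixes f :: "'i \<Rightarrow> 'a::real_normed_vector"
  assumes "(\<lambda>x. (norm (f x))\<^sup>2) summable_on A"
  shows "(\<lambda>x. (norm (c *\<^sub>R f x))\<^sup>2) summable_on A"
  using summable_on_cmult_right[OF assms, of "c\<^sup>2"] by (simp add: power_mult_distrib)

lemma inner_summable:
  fixes f g :: "'i \<Rightarrow> 'a::real_inner"
  assumes "(\<lambda>x. (norm (f x))\<^sup>2) summable_on A" "(\<lambda>x. (norm (g x))\<^sup>2) summable_on A"
  shows "(\<lambda>x. f x \<bullet> g x) summable_on A"
proof -
  have "(\<lambda>x. ((norm (f x + g x))\<^sup>2 + (- 1) * (norm (f x))\<^sup>2 + (- 1) * (norm (g x))\<^sup>2) * (1/2))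
          summable_on A"
    by (intro summable_on_cmult_left summable_on_add summable_on_cmult_right square_summable_add assms)
  then show ?thesis
    by (simp add: power2_norm_eq_inner inner_add_left inner_add_right inner_commute)
qed

instantiation l2 :: real_vector
begin

lift_definition zero_l2 :: l2 is "\<lambda>_. 0" by simp
lift_definition plus_l2 :: "l2 \<Rightarrow> l2 \<Rightarrow> l2" is "\<lambda>f g x. f x + g x"
  by (auto intro: square_summable_add)
lift_definition uminus_l2 :: "l2 \<Rightarrow> l2" is "\<lambda>f x. - f x" by simp
lift_definition minus_l2 :: "l2 \<Rightarrow> l2 \<Rightarrow> l2" is "\<lambda>f g x. f x - g x"
  using square_summable_add[where g = "\<lambda>x. - g x" for g] by force
lift_definition scaleR_l2 :: "real \<Rightarrow> l2 \<Rightarrow> l2" is "\<lambda>c f x. c *\<^sub>R f x"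
  using square_summable_scaleR by auto

instance
  by standard (transfer; force simp: scaleR_add_left scaleR_add_right)+

end

text \<open>
  The inner product of the class \<^class>\<open>real_inner\<close> on \<open>complex^2\<close> is the real part of the hermitian
  one. The norms induced on the sequence space by the two agree, and with them
  the bounded operators and the convergence of operators.
\<close>

instantiation l2 :: real_inner
begin

lift_definition inner_l2 :: "l2 \<Rightarrow> l2 \<Rightarrow> real" is "\<lambda>f g. \<Sum>\<^sub>\<infinity>x. f x \<bullet> g x" .
definition norm_l2 :: "l2 \<Rightarrow> real" where "norm_l2 f = sqrt (f \<bullet> f)"
definition dist_l2 :: "l2 \<Rightarrow> l2 \<Rightarrow> real" where "dist_l2 f g = norm (f - g)"
definition sgn_l2 :: "l2 \<Rightarrow> l2" where "sgn_l2 f = f /\<^sub>R norm f"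
definition uniformity_l2 :: "(l2 \<times> l2) filter"
  where "uniformity_l2 = (INF e\<in>{0<..}. principal {(f, g). dist f g < e})"
definition open_l2 :: "l2 set \<Rightarrow> bool"
  where "open_l2 U = (\<forall>f\<in>U. \<forall>\<^sub>F (f', g) in uniformity. f' = f \<longrightarrow> g \<in> U)"

instance
proof
  fix f g h :: l2 and c :: real
  show "dist f g = norm (f - g)" "sgn f = f /\<^sub>R norm f" "norm f = sqrt (f \<bullet> f)"
    "uniformity = (INF e\<in>{0<..}. principal {(f :: l2, g). dist f g < e})"
    by (simp_all add: dist_l2_def sgn_l2_def norm_l2_def uniformity_l2_def)
  show "open U = (\<forall>f\<in>U. \<forall>\<^sub>F (f', g) in uniformity. f' = f \<longrightarrow> g \<in> U)" for U :: "l2 set"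
    by (simp add: open_l2_def)
  show "f \<bullet> g = g \<bullet> f"
    by transfer (simp add: inner_commute)
  show "(f + g) \<bullet> h = f \<bullet> h + g \<bullet> h"
    by transfer (auto simp: inner_add_left intro!: infsum_add inner_summable)
  show "(c *\<^sub>R f) \<bullet> g = c * (f \<bullet> g)"
    by transfer (auto intro!: infsum_cmult_right inner_summable)
  show "0 \<le> f \<bullet> f"
    by transfer (auto intro: infsum_nonneg)
  show "(f \<bullet> f = 0) = (f = 0)"
  proof
    assume "f \<bullet> f = 0"
    then have "(\<Sum>\<^sub>\<infinity>x. l2_apply f x \<bullet> l2_apply f x) = 0" by transfer
    then have "l2_apply f x \<bullet> l2_apply f x = 0" for x
      by (rule nonneg_infsum_le_0D[OF eq_refl])
         (use inner_summable[OF l2_summable l2_summable] in auto)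
    then show "f = 0" by (intro l2_eqI) (simp add: zero_l2.rep_eq)
  qed (transfer, simp)
qed

end

lemma norm_l2_square: "(norm f)\<^sup>2 = (\<Sum>\<^sub>\<infinity>x. (norm (l2_apply f x))\<^sup>2)"
  by (simp add: power2_norm_eq_inner inner_l2.rep_eq)

lemma sum_le_norm_l2_square: "finite S \<Longrightarrow> (\<Sum>x\<in>S. (norm (l2_apply f x))\<^sup>2) \<le> (norm f)\<^sup>2"
  unfolding norm_l2_square by (rule finite_sum_le_infsum) (auto intro: l2_summable)

lemma norm_l2_apply_le: "norm (l2_apply f x) \<le> norm f"
  using sum_le_norm_l2_square[of "{x}" f] by (simp add: abs_le_square_iff[symmetric])

lemma norm_l2_le:
  assumes "\<And>S. finite S \<Longrightarrow> (\<Sum>x\<in>S. (norm (l2_apply f x))\<^sup>2) \<le> c\<^sup>2" "0 \<le> c"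
  shows "norm f \<le> c"
proof -
  have "(norm f)\<^sup>2 \<le> c\<^sup>2"
    unfolding norm_l2_square using assms(1) by (intro infsum_le_finite_sums l2_summable) auto
  then show ?thesis using \<open>0 \<le> c\<close> by (rule power2_le_imp_le)
qed

instance l2 :: complete_space
proof
  fix X :: "nat \<Rightarrow> l2"
  assume X: "Cauchy X"
  have "Cauchy (\<lambda>n. l2_apply (X n) x)" for x
  proof (rule metric_CauchyI)
    fix e :: real assume "e > 0"
    then obtain N where "\<forall>m\<ge>N. \<forall>n\<ge>N. dist (X m) (X n) < e" using X by (auto simp: Cauchy_def)
    moreover have "dist (l2_apply (X m) x) (l2_apply (X n) x) \<le> dist (X m) (X n)" for m n
      using norm_l2_apply_le[of "X m - X n" x] by (simp add: dist_norm minus_l2.rep_eq)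
    ultimately show "\<exists>N. \<forall>m\<ge>N. \<forall>n\<ge>N. dist (l2_apply (X m) x) (l2_apply (X n) x) < e"
      by (meson le_less_trans)
  qed
  then have "\<exists>g. \<forall>x. (\<lambda>n. l2_apply (X n) x) \<longlonglongrightarrow> g x"
    by (intro choice allI Cauchy_convergent[unfolded convergent_def])
  then obtain g where g: "\<And>x. (\<lambda>n. l2_apply (X n) x) \<longlonglongrightarrow> g x" by blast
  have bound: "\<exists>N. \<forall>m\<ge>N. \<forall>S. finite S \<longrightarrow>
                 (\<Sum>x\<in>S. (norm (l2_apply (X m) x - g x))\<^sup>2) \<le> e\<^sup>2" if "e > 0" for e :: real
  proof -
    obtain N where N: "\<And>m n. m \<ge> N \<Longrightarrow> n \<ge> N \<Longrightarrow> norm (X m - X n) < e"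
      using metric_CauchyD[OF X \<open>e > 0\<close>] by (auto simp: dist_norm)
    have "(\<Sum>x\<in>S. (norm (l2_apply (X m) x - g x))\<^sup>2) \<le> e\<^sup>2" if "m \<ge> N" "finite S" for m S
    proof (rule LIMSEQ_le_const2)
      show "(\<lambda>n. \<Sum>x\<in>S. (norm (l2_apply (X m) x - l2_apply (X n) x))\<^sup>2)
              \<longlonglongrightarrow> (\<Sum>x\<in>S. (norm (l2_apply (X m) x - g x))\<^sup>2)"
        by (intro tendsto_intros g)
      have "(\<Sum>x\<in>S. (norm (l2_apply (X m) x - l2_apply (X n) x))\<^sup>2) \<le> e\<^sup>2" if "n \<ge> N" for n
      proof -
        have "(norm (X m - X n))\<^sup>2 \<le> e\<^sup>2"
          using N[OF \<open>m \<ge> N\<close> that] by (intro power_mono) auto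
        then show ?thesis
          using sum_le_norm_l2_square[OF \<open>finite S\<close>, of "X m - X n"] by (simp add: minus_l2.rep_eq)
      qed
      then show "\<exists>N. \<forall>n\<ge>N. (\<Sum>x\<in>S. (norm (l2_apply (X m) x - l2_apply (X n) x))\<^sup>2) \<le> e\<^sup>2"
        by blast
    qed
    then show ?thesis by blast
  qed
  obtain M where M: "\<And>S. finite S \<Longrightarrow> (\<Sum>x\<in>S. (norm (l2_apply (X M) x - g x))\<^sup>2) \<le> 1\<^sup>2"
    using bound[of 1] by auto
  have "(\<lambda>x. (norm (l2_apply (X M) x - g x))\<^sup>2) summable_on UNIV"
    by (rule nonneg_bounded_partial_sums_imp_summable_on[where C = "1\<^sup>2"])
       (use M in \<open>auto simp: eventually_finite_subsets_at_top\<close>)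
  then have "(\<lambda>x. (norm (- (l2_apply (X M) x - g x)))\<^sup>2) summable_on UNIV"
    by (simp add: norm_minus_commute)
  from square_summable_add[OF l2_summable[of "X M"] this]
  have "(\<lambda>x. (norm (g x))\<^sup>2) summable_on UNIV" by simp
  then have Abs: "l2_apply (Abs_l2 g) = g" by (simp add: Abs_l2_inverse)
  have "X \<longlonglongrightarrow> Abs_l2 g"
  proof (rule metric_LIMSEQ_I)
    fix e :: real assume "e > 0"
    then obtain N where N: "\<And>m S. m \<ge> N \<Longrightarrow> finite S \<Longrightarrow>
        (\<Sum>x\<in>S. (norm (l2_apply (X m) x - g x))\<^sup>2) \<le> (e/2)\<^sup>2"
      using bound[of "e/2"] by auto
    have "norm (X m - Abs_l2 g) \<le> e/2" if "m \<ge> N" for m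
      using N[OF that] \<open>e > 0\<close> by (intro norm_l2_le) (auto simp: minus_l2.rep_eq Abs)
    then show "\<exists>N. \<forall>m\<ge>N. dist (X m) (Abs_l2 g) < e"
      using \<open>e > 0\<close> by (force simp: dist_norm)
  qed
  then show "convergent X" by (auto simp: convergent_def)
qed


section \<open>Matrix operators and shifts\<close>

lemma matrix_square_summable:
  fixes A :: "complex^2^2" and f :: "int \<Rightarrow> complex^2"
  assumes "(\<lambda>x. (norm (f x))\<^sup>2) summable_on UNIV"
  shows "(\<lambda>x. (norm (A *v f x))\<^sup>2) summable_on UNIV"
proof (rule summable_on_comparison_test)
  show "(\<lambda>x. (onorm ((*v) A))\<^sup>2 * (norm (f x))\<^sup>2) summable_on UNIV"
    by (intro summable_on_cmult_right assms)
  show "(norm (A *v f x))\<^sup>2 \<le> (onorm ((*v) A))\<^sup>2 * (norm (f x))\<^sup>2" for x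
    unfolding power_mult_distrib[symmetric] by (intro power_mono onorm) auto
qed auto

lift_definition matrix_l2 :: "complex^2^2 \<Rightarrow> l2 \<Rightarrow> l2" is "\<lambda>A f x. A *v f x"
  using matrix_square_summable by auto

lemma shift_square_summable:
  fixes f :: "int \<Rightarrow> complex^2"
  assumes "(\<lambda>x. (norm (f x))\<^sup>2) summable_on UNIV"
  shows "(\<lambda>x. (norm (f (x - y)))\<^sup>2) summable_on UNIV"
  using assms summable_on_reindex_bij_betw[of "\<lambda>x. x - y" UNIV UNIV "\<lambda>x. (norm (f x))\<^sup>2"]
  by (simp add: bij_diff_right)

lift_definition shift_l2 :: "int \<Rightarrow> l2 \<Rightarrow> l2" is "\<lambda>y f x. f (x - y)"
  using shift_square_summable by auto

lift_definition matrix_op :: "complex^2^2 \<Rightarrow> l2 \<Rightarrow>\<^sub>L l2" is matrix_l2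
proof
  fix A :: "complex^2^2"
  show "matrix_l2 A (f + g) = matrix_l2 A f + matrix_l2 A g" for f g
    by transfer (simp add: matrix_vector_right_distrib)
  show "matrix_l2 A (c *\<^sub>R f) = c *\<^sub>R matrix_l2 A f" for c f
    by transfer (simp add: linear_cmul[OF matrix_vector_mul_linear])
  have "norm (matrix_l2 A f) \<le> norm f * onorm ((*v) A)" for f
  proof (rule norm_l2_le)
    fix S :: "int set" assume "finite S"
    have "(\<Sum>x\<in>S. (norm (l2_apply (matrix_l2 A f) x))\<^sup>2)
            \<le> (\<Sum>x\<in>S. (onorm ((*v) A))\<^sup>2 * (norm (l2_apply f x))\<^sup>2)"
      unfolding power_mult_distrib[symmetric] matrix_l2.rep_eq
      by (intro sum_mono power_mono onorm) auto
    also have "\<dots> \<le> (onorm ((*v) A))\<^sup>2 * (norm f)\<^sup>2"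
      unfolding sum_distrib_left[symmetric]
      by (intro mult_left_mono sum_le_norm_l2_square \<open>finite S\<close>) auto
    finally show "(\<Sum>x\<in>S. (norm (l2_apply (matrix_l2 A f) x))\<^sup>2) \<le> (norm f * onorm ((*v) A))\<^sup>2"
      by (simp add: power_mult_distrib mult.commute)
  qed (simp add: onorm_pos_le)
  then show "\<exists>K. \<forall>f. norm (matrix_l2 A f) \<le> norm f * K" by blast
qed

text \<open>The integer power \<open>y\<close> of the shift operator; see \<open>shift_power_1\<close>, \<open>shift_power_0\<close> and
  \<open>shift_power_add\<close> below.\<close>

lift_definition shift_power :: "int \<Rightarrow> l2 \<Rightarrow>\<^sub>L l2" is shift_l2
proof
  fix y :: int
  show "shift_l2 y (f + g) = shift_l2 y f + shift_l2 y g" for f g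
    by transfer simp
  show "shift_l2 y (c *\<^sub>R f) = c *\<^sub>R shift_l2 y f" for c f
    by transfer simp
  have "norm (shift_l2 y f) \<le> norm f * 1" for f
  proof (rule norm_l2_le)
    fix S :: "int set" assume "finite S"
    have "(\<Sum>x\<in>S. (norm (l2_apply (shift_l2 y f) x))\<^sup>2)
            = (\<Sum>x\<in>(\<lambda>x. x - y) ` S. (norm (l2_apply f x))\<^sup>2)"
      by (subst sum.reindex) (auto simp: inj_on_def shift_l2.rep_eq)
    also have "\<dots> \<le> (norm f)\<^sup>2"
      using \<open>finite S\<close> by (intro sum_le_norm_l2_square) auto
    finally show "(\<Sum>x\<in>S. (norm (l2_apply (shift_l2 y f) x))\<^sup>2) \<le> (norm f * 1)\<^sup>2" by simp
  qed simp
  then show "\<exists>K. \<forall>f. norm (shift_l2 y f) \<le> norm f * K" by blast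
qed

lemma matrix_op_apply: "l2_apply (matrix_op A f) x = A *v l2_apply f x"
  by (simp add: matrix_op.rep_eq matrix_l2.rep_eq)

lemma shift_power_apply: "l2_apply (shift_power y f) x = l2_apply f (x - y)"
  by (simp add: shift_power.rep_eq shift_l2.rep_eq)

lemma shift_power_1: "l2_apply (shift_power 1 f) x = l2_apply f (x - 1)"
  by (rule shift_power_apply)

lemma shift_power_0: "shift_power 0 = id_blinfun"
  by (intro blinfun_eqI l2_eqI) (simp add: shift_power_apply)

lemma shift_power_add: "shift_power (y + z) = shift_power y o\<^sub>L shift_power z"
  by (intro blinfun_eqI l2_eqI) (simp add: shift_power_apply algebra_simps)


section \<open>The operator associated with a special unitary matrix\<close>

definition special_unitary :: "complex^2^2 \<Rightarrow> bool" where
  "special_unitary T \<longleftrightarrow> T ** (\<chi> i j. cnj (T $ j $ i)) = mat 1 \<and> det T = 1"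

definition fourier :: "(real \<Rightarrow> complex) \<Rightarrow> int \<Rightarrow> complex" where
  "fourier k x =
     1 / (2 * of_real pi) * integral {0..2*pi} (\<lambda>\<theta>. exp (- \<i> * of_int x * of_real \<theta>) * k \<theta>)"

definition phase :: "real \<Rightarrow> real \<Rightarrow> real" where
  "phase s \<theta> = arccos (s * cos \<theta>)"

definition I_coeff :: "real \<Rightarrow> int \<Rightarrow> complex" where
  "I_coeff s = fourier (\<lambda>\<theta>. of_real (sin \<theta> * (phase s \<theta> / sin (phase s \<theta>))))"

definition J_coeff :: "real \<Rightarrow> int \<Rightarrow> complex" where
  "J_coeff s = fourier (\<lambda>\<theta>. of_real (phase s \<theta> / sin (phase s \<theta>)))"

definition D_symbol :: "complex^2^2 \<Rightarrow> int \<Rightarrow> complex^2^2" where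
  "D_symbol T x =
     (let a = T $ 1 $ 1; b = T $ 1 $ 2; s = cmod a; r = cmod b;
          \<alpha> = a / of_real s; \<beta> = b / of_real r
      in vector
        [vector [of_real s * \<alpha> powi x * I_coeff s x,
                 - \<i> * of_real r * \<alpha> powi (x + 1) * \<beta> * J_coeff s (x + 1)],
         vector [\<i> * of_real r * \<alpha> powi (x - 1) * inverse \<beta> * J_coeff s (x - 1),
                 - of_real s * \<alpha> powi x * I_coeff s x]])"

text \<open>The sum is taken in operator norm. For special unitary \<open>T\<close> with nonzero entries the integrands
  above are smooth and periodic, so the series converges absolutely.\<close>

definition D_op :: "complex^2^2 \<Rightarrow> l2 \<Rightarrow>\<^sub>L l2" where
  "D_op T = (\<Sum>\<^sub>\<infinity>y. matrix_op (D_symbol T y) o\<^sub>L shift_power y)"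

end

theory Submission
  imports Defs "HOL-Complex_Analysis.Cauchy_Integral_Formula"
begin

text \<open>
  On the Fourier side \<open>\<tau>\<close> becomes multiplication by a unimodular number \<open>z\<close>. With \<open>\<alpha> z = e\<^sup>i\<^sup>\<theta>\<close>,
  \<open>q = \<phi>\<^sub>s / sin \<phi>\<^sub>s\<close> and \<open>p = sin \<theta> q\<close>, the symbol of \<open>D(T)\<close> has diagonal entries \<open>s p\<close> and
  \<open>- s p\<close> and off-diagonal entries \<open>- \<i> r \<beta> q / z\<close> and \<open>\<i> r z q / \<beta>\<close>. It is a traceless matrix, so
  its square is the scalar \<open>s\<^sup>2 p\<^sup>2 + r\<^sup>2 q\<^sup>2 = (s\<^sup>2 sin\<^sup>2 \<theta> + r\<^sup>2) \<phi>\<^sub>s\<^sup>2 / sin\<^sup>2 \<phi>\<^sub>s\<close>, which is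
  \<open>\<phi>\<^sub>s\<^sup>2\<close> because \<open>sin\<^sup>2 \<phi>\<^sub>s = 1 - s\<^sup>2 cos\<^sup>2 \<theta> = r\<^sup>2 + s\<^sup>2 sin\<^sup>2 \<theta>\<close> (\<open>phase_square\<close>).

  The sums are taken in operator norm, so the computation is carried out on the coefficients
  instead of under the Fourier transform. It rests on the Wiener algebra of functions with absolutely
  convergent Fourier series, in which products correspond to convolutions (\<open>wiener_mult\<close>). The
  function \<open>q\<close> belongs to it since \<open>arccos x / sqrt (1 - x\<^sup>2)\<close> is a power series in \<open>x\<close>, convergent on
  the unit disc, evaluated at \<open>s cos \<theta>\<close> with \<open>s < 1\<close>, and the powers of the cosine are
  trigonometric polynomials with nonnegative coefficients summing to one (\<open>wiener_phase_quotient\<close>).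
  Membership of \<open>p\<close> and of \<open>\<phi>\<^sub>s\<^sup>2\<close> and the convolution identities for \<open>I\<close> and \<open>J\<close> follow by
  algebra. Because absolutely summable matrix coefficients give operator series that are multiplied
  by convolution (\<open>has_sum_matrix_shift_compose\<close>), what remains is the convolution square of the
  coefficients (\<open>has_sum_D_symbol_square\<close>).
\<close>

section \<open>Products of absolutely convergent sums\<close>

lemma has_sum_bilinear_product:
  fixes u :: "'i \<Rightarrow> 'a::banach" and v :: "'j \<Rightarrow> 'b::banach"
    and prod :: "'a \<Rightarrow> 'b \<Rightarrow> 'c::banach"
  assumes "bounded_bilinear prod"
    and u: "(\<lambda>x. norm (u x)) summable_on A" and v: "(\<lambda>y. norm (v y)) summable_on B"
  shows "(\<lambda>(x, y). norm (prod (u x) (v y))) summable_on A \<times> B"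
    and "((\<lambda>(x, y). prod (u x) (v y)) has_sum prod (infsum u A) (infsum v B)) (A \<times> B)"
proof -
  interpret bounded_bilinear prod by fact
  obtain K where K: "\<And>a b. norm (prod a b) \<le> norm a * norm b * K" "0 \<le> K"
    using nonneg_bounded by blast
  have "(\<lambda>(x, y). norm (u x) * norm (v y) * K) summable_on A \<times> B"
  proof (rule summable_on_SigmaI)
    show "((\<lambda>y. (\<lambda>(x, y). norm (u x) * norm (v y) * K) (x, y)) has_sum
             norm (u x) * infsum (\<lambda>y. norm (v y)) B * K) B" for x
      using v by (auto intro!: has_sum_cmult_left has_sum_cmult_right has_sum_infsum)
    show "(\<lambda>x. norm (u x) * infsum (\<lambda>y. norm (v y)) B * K) summable_on A"
      by (intro summable_on_cmult_left u)
  qed (use K in auto)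
  then have norm: "(\<lambda>p. norm (prod (u (fst p)) (v (snd p)))) summable_on A \<times> B"
    by (rule Infinite_Sum.abs_summable_on_comparison_test') (use K in auto)
  then show "(\<lambda>(x, y). norm (prod (u x) (v y))) summable_on A \<times> B"
    by (simp add: case_prod_unfold)
  show "((\<lambda>(x, y). prod (u x) (v y)) has_sum prod (infsum u A) (infsum v B)) (A \<times> B)"
  proof (rule has_sum_SigmaI)
    show "((\<lambda>y. (\<lambda>(x, y). prod (u x) (v y)) (x, y)) has_sum prod (u x) (infsum v B)) B" for x
      using has_sum_bounded_linear[OF bounded_linear_right has_sum_infsum[OF abs_summable_summable[OF v]]]
      by simp
    show "((\<lambda>x. prod (u x) (infsum v B)) has_sum prod (infsum u A) (infsum v B)) A"
      by (rule has_sum_bounded_linear[OF bounded_linear_left has_sum_infsum[OF abs_summable_summable[OF u]]])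
    show "(\<lambda>(x, y). prod (u x) (v y)) summable_on A \<times> B"
      using abs_summable_summable[OF norm] by (simp add: case_prod_unfold)
  qed
qed

lemma has_sum_antidiagonals:
  fixes f :: "int \<Rightarrow> int \<Rightarrow> 'a::{topological_comm_monoid_add,t3_space}"
  assumes "((\<lambda>(y, z). f y z) has_sum S) UNIV"
    and "\<And>w. ((\<lambda>y. f y (w - y)) has_sum g w) UNIV"
  shows "(g has_sum S) UNIV"
proof (rule has_sum_SigmaD[where B = "\<lambda>_. UNIV"])
  have "((\<lambda>(w, y). f y (w - y)) has_sum S) UNIV \<longleftrightarrow> ((\<lambda>(y, z). f y z) has_sum S) UNIV"
    by (rule has_sum_reindex_bij_witness[where i = "\<lambda>(y, z). (y + z, y)" and j = "\<lambda>(w, y). (y, w - y)"]) auto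
  then show "((\<lambda>(w, y). f y (w - y)) has_sum S) (UNIV \<times> UNIV)"
    using assms(1) by simp
qed (use assms(2) in simp)

section \<open>Absolutely convergent Fourier series\<close>

lemma has_integral_exp_period:
  "((\<lambda>\<theta>. exp (\<i> * of_int n * of_real \<theta>)) has_integral (if n = 0 then 2 * of_real pi else 0)) {0..2*pi}"
proof (cases "n = 0")
  case True
  then show ?thesis using has_integral_const_real[of "1::complex" 0 "2*pi"] by (simp add: scaleR_conv_of_real)
next
  case False
  define F where "F \<theta> = exp (\<i> * of_int n * of_real \<theta>) / (\<i> * of_int n)" for \<theta> :: real
  have d: "(F has_vector_derivative exp (\<i> * of_int n * of_real \<theta>)) (at \<theta> within {0..2*pi})" for \<theta>
  proof -
    have "((\<lambda>z. exp (\<i> * of_int n * z) / (\<i> * of_int n)) has_field_derivative exp (\<i> * of_int n * of_real \<theta>))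
            (at (of_real \<theta>))"
      using False by (auto intro!: derivative_eq_intros)
    then show ?thesis
      unfolding F_def by (rule has_vector_derivative_real_field)
  qed
  have "F (2*pi) = F 0"
    using exp_integer_2pi[of "of_int n"] by (simp add: F_def mult_ac)
  then show ?thesis
    using fundamental_theorem_of_calculus[OF _ d] False by simp
qed

text \<open>Termwise integration, justified by uniform convergence. The exponents \<open>m\<close> may repeat: sums
  indexed by pairs then serve products and sums indexed by the terms of binomial expansions serve
  power series in the cosine, with no rearrangement beforehand.\<close>

lemma has_sum_fourier_fibre:
  fixes c :: "'i \<Rightarrow> complex" and m :: "'i \<Rightarrow> int"
  assumes c: "(\<lambda>i. norm (c i)) summable_on A"
    and f: "\<And>\<theta>. ((\<lambda>i. c i * exp (\<i> * of_int (m i) * of_real \<theta>)) has_sum f \<theta>) A"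
  shows "(c has_sum fourier f x) {i \<in> A. m i = x}"
proof -
  define e where "e i \<theta> = exp (- \<i> * of_int x * of_real \<theta>) * (c i * exp (\<i> * of_int (m i) * of_real \<theta>))"
    for i and \<theta> :: real
  have e_eq: "e i \<theta> = c i * exp (\<i> * of_int (m i - x) * of_real \<theta>)" for i \<theta>
    by (simp add: e_def exp_add[symmetric] algebra_simps)
  have lim: "uniform_limit {0..2*pi} (\<lambda>X \<theta>. \<Sum>i\<in>X. e i \<theta>)
               (\<lambda>\<theta>. exp (- \<i> * of_int x * of_real \<theta>) * f \<theta>) (finite_subsets_at_top A)"
  proof (rule Weierstrass_m_test_general'[OF _ _ c])
    show "norm (e i \<theta>) \<le> norm (c i)" for i \<theta>
      by (simp add: e_eq norm_mult)
    show "((\<lambda>i. e i \<theta>) has_sum exp (- \<i> * of_int x * of_real \<theta>) * f \<theta>) A" for \<theta>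
      unfolding e_def by (intro has_sum_cmult_right f)
  qed
  have cont: "continuous_on {0..2*pi} (\<lambda>\<theta>. \<Sum>i\<in>X. e i \<theta>)" for X
    unfolding e_eq by (intro continuous_intros)
  obtain I J where I: "\<And>X. ((\<lambda>\<theta>. \<Sum>i\<in>X. e i \<theta>) has_integral I X) {0..2*pi}"
    and J: "((\<lambda>\<theta>. exp (- \<i> * of_int x * of_real \<theta>) * f \<theta>) has_integral J) {0..2*pi}"
    and IJ: "(I \<longlongrightarrow> J) (finite_subsets_at_top A)"
    by (rule uniform_limit_integral[OF lim cont]) auto
  define d where "d i = c i * (if m i - x = 0 then 2 * of_real pi else 0)" for i
  have "((\<lambda>\<theta>. \<Sum>i\<in>X. e i \<theta>) has_integral (\<Sum>i\<in>X. d i)) {0..2*pi}" if "finite X" for X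
    unfolding e_eq d_def by (intro has_integral_sum that has_integral_mult_right has_integral_exp_period)
  then have "I X = (\<Sum>i\<in>X. d i)" if "finite X" for X
    using I has_integral_unique that by blast
  then have "(d has_sum J) A"
    unfolding has_sum_def using IJ
    by (elim Lim_transform_eventually) (auto simp: eventually_finite_subsets_at_top)
  then have "((\<lambda>i. 1 / (2 * of_real pi) * d i) has_sum 1 / (2 * of_real pi) * J) A"
    by (rule has_sum_cmult_right)
  also have "1 / (2 * of_real pi) * J = fourier f x"
    using J by (simp add: fourier_def integral_unique)
  finally have "((\<lambda>i. 1 / (2 * of_real pi) * d i) has_sum fourier f x) A" .
  then show ?thesis
    by (rule has_sum_cong_neutral[THEN iffD1, rotated -1]) (auto simp: d_def)
qed

text \<open>The Wiener algebra. Pointwise convergence to \<open>f\<close> is part of the definition, which therefore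
  carries Fourier inversion along; \<open>wienerI\<close> obtains it from any absolutely convergent
  trigonometric series for \<open>f\<close>.\<close>

definition wiener :: "(real \<Rightarrow> complex) \<Rightarrow> bool" where
  "wiener f \<longleftrightarrow> (\<lambda>y. norm (fourier f y)) summable_on UNIV \<and>
     (\<forall>\<theta>. ((\<lambda>y. fourier f y * exp (\<i> * of_int y * of_real \<theta>)) has_sum f \<theta>) UNIV)"

text \<open>Absolute convergence allows the terms with equal exponents to be collected, and the collected
  coefficients are the Fourier coefficients by the preceding lemma.\<close>

lemma wienerI:
  fixes c :: "'i \<Rightarrow> complex" and m :: "'i \<Rightarrow> int"
  assumes c: "(\<lambda>i. norm (c i)) summable_on A"
    and f: "\<And>\<theta>. ((\<lambda>i. c i * exp (\<i> * of_int (m i) * of_real \<theta>)) has_sum f \<theta>) A"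
  shows "wiener f"
proof -
  define B where "B x = {i \<in> A. m i = x}" for x
  have fibre: "(c has_sum fourier f x) (B x)" for x
    unfolding B_def by (rule has_sum_fourier_fibre[OF c f])
  have B: "(\<lambda>i. norm (c i)) summable_on B x" for x
    by (rule summable_on_subset_banach[OF c]) (auto simp: B_def)
  have reindex: "((\<lambda>(x, i). h i) has_sum S) (Sigma UNIV B) \<longleftrightarrow> (h has_sum S) A"
    for h :: "'i \<Rightarrow> 'b::{comm_monoid_add,topological_space}" and S
    by (rule has_sum_reindex_bij_witness[where j = snd and i = "\<lambda>i. (m i, i)"]) (auto simp: B_def)
  have "((\<lambda>(x, i). norm (c i)) has_sum infsum (\<lambda>i. norm (c i)) A) (Sigma UNIV B)"
    using has_sum_infsum[OF c] by (simp add: reindex)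
  then have "((\<lambda>x. infsum (\<lambda>i. norm (c i)) (B x)) has_sum infsum (\<lambda>i. norm (c i)) A) UNIV"
    by (rule has_sum_SigmaD) (use has_sum_infsum[OF B] in simp)
  then have "(\<lambda>x. infsum (\<lambda>i. norm (c i)) (B x)) summable_on UNIV"
    by (rule has_sum_imp_summable)
  then have 1: "(\<lambda>x. norm (fourier f x)) summable_on UNIV"
  proof (rule Infinite_Sum.abs_summable_on_comparison_test')
    show "norm (fourier f x) \<le> infsum (\<lambda>i. norm (c i)) (B x)" for x
      using norm_infsum_bound[OF B] infsumI[OF fibre] by metis
  qed
  have "((\<lambda>(x, i). c i * exp (\<i> * of_int (m i) * of_real \<theta>)) has_sum f \<theta>) (Sigma UNIV B)" for \<theta>
    using f by (simp add: reindex)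
  then have "((\<lambda>x. fourier f x * exp (\<i> * of_int x * of_real \<theta>)) has_sum f \<theta>) UNIV" for \<theta>
  proof (rule has_sum_SigmaD)
    fix x :: int
    have "((\<lambda>i. c i * exp (\<i> * of_int x * of_real \<theta>)) has_sum fourier f x * exp (\<i> * of_int x * of_real \<theta>)) (B x)"
      by (intro has_sum_cmult_left fibre)
    then show "((\<lambda>i. (\<lambda>(x, i). c i * exp (\<i> * of_int (m i) * of_real \<theta>)) (x, i))
                 has_sum fourier f x * exp (\<i> * of_int x * of_real \<theta>)) (B x)"
      by (rule has_sum_cong[THEN iffD1, rotated]) (auto simp: B_def)
  qed
  with 1 show ?thesis by (auto simp: wiener_def)
qed

text \<open>The combined series converges absolutely to \<open>a f + b g\<close>, and termwise integration shows that
  the coefficients of such a series are determined by its sum.\<close>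

lemma fourier_combination:
  assumes "wiener f" "wiener g"
  shows "fourier (\<lambda>\<theta>. a * f \<theta> + b * g \<theta>) x = a * fourier f x + b * fourier g x"
proof -
  let ?c = "\<lambda>y. a * fourier f y + b * fourier g y"
  have "(\<lambda>y. norm a * norm (fourier f y) + norm b * norm (fourier g y)) summable_on UNIV"
    using assms by (intro summable_on_add summable_on_cmult_right) (auto simp: wiener_def)
  then have c: "(\<lambda>y. norm (?c y)) summable_on UNIV"
    by (rule Infinite_Sum.abs_summable_on_comparison_test') (metis norm_mult norm_triangle_ineq)
  have f: "((\<lambda>y. ?c y * exp (\<i> * of_int y * of_real \<theta>)) has_sum a * f \<theta> + b * g \<theta>) UNIV" for \<theta>
  proof -
    have "((\<lambda>y. a * (fourier f y * exp (\<i> * of_int y * of_real \<theta>))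
              + b * (fourier g y * exp (\<i> * of_int y * of_real \<theta>))) has_sum a * f \<theta> + b * g \<theta>) UNIV"
      using assms by (intro has_sum_add has_sum_cmult_right) (auto simp: wiener_def)
    then show ?thesis by (simp add: algebra_simps)
  qed
  have "(?c has_sum fourier (\<lambda>\<theta>. a * f \<theta> + b * g \<theta>) x) {y \<in> UNIV. y = x}"
    by (rule has_sum_fourier_fibre[OF c f])
  moreover have "(?c has_sum ?c x) {x}"
    by (rule has_sum_finiteI) auto
  ultimately show ?thesis
    by (simp add: has_sum_unique)
qed

lemma wiener_mult:
  assumes "wiener f" "wiener g"
  shows "wiener (\<lambda>\<theta>. f \<theta> * g \<theta>)"
    and "((\<lambda>y. fourier f y * fourier g (w - y)) has_sum fourier (\<lambda>\<theta>. f \<theta> * g \<theta>) w) UNIV"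
proof -
  let ?c = "\<lambda>p. fourier f (fst p) * fourier g (snd p)" and ?m = "\<lambda>p::int \<times> int. fst p + snd p"
  have f: "(\<lambda>y. norm (fourier f y)) summable_on UNIV"
    "\<And>\<theta>. ((\<lambda>y. fourier f y * exp (\<i> * of_int y * of_real \<theta>)) has_sum f \<theta>) UNIV"
    and g: "(\<lambda>y. norm (fourier g y)) summable_on UNIV"
    "\<And>\<theta>. ((\<lambda>y. fourier g y * exp (\<i> * of_int y * of_real \<theta>)) has_sum g \<theta>) UNIV"
    using assms by (auto simp: wiener_def)
  have c: "(\<lambda>p. norm (?c p)) summable_on UNIV"
    using has_sum_bilinear_product(1)[OF bounded_bilinear_mult f(1) g(1)] by (simp add: case_prod_unfold)
  have s: "((\<lambda>p. ?c p * exp (\<i> * of_int (?m p) * of_real \<theta>)) has_sum f \<theta> * g \<theta>) UNIV" for \<theta>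
  proof -
    let ?f = "\<lambda>y. fourier f y * exp (\<i> * of_int y * of_real \<theta>)"
    let ?g = "\<lambda>y. fourier g y * exp (\<i> * of_int y * of_real \<theta>)"
    have "((\<lambda>(y, z). ?f y * ?g z) has_sum infsum ?f UNIV * infsum ?g UNIV) (UNIV \<times> UNIV)"
      by (rule has_sum_bilinear_product(2)[OF bounded_bilinear_mult])
         (use f(1) g(1) in \<open>simp_all add: norm_mult\<close>)
    then show ?thesis
      unfolding infsumI[OF f(2)] infsumI[OF g(2)]
      by (simp add: case_prod_unfold exp_add ring_distribs mult_ac)
  qed
  show "wiener (\<lambda>\<theta>. f \<theta> * g \<theta>)"
    by (rule wienerI[OF c s])
  have "(?c has_sum fourier (\<lambda>\<theta>. f \<theta> * g \<theta>) w) {p \<in> UNIV. ?m p = w}"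
    by (rule has_sum_fourier_fibre[OF c s])
  then show "((\<lambda>y. fourier f y * fourier g (w - y)) has_sum fourier (\<lambda>\<theta>. f \<theta> * g \<theta>) w) UNIV"
    by (rule has_sum_reindex_bij_witness[where i = "\<lambda>y. (y, w - y)" and j = fst, THEN iffD1, rotated -1]) auto
qed

lemma wiener_sin: "wiener (\<lambda>\<theta>. of_real (sin \<theta>))"
proof (rule wienerI[where A = "{1, -1}" and m = "\<lambda>y. y" and c = "\<lambda>y. of_int y / (2 * \<i>)"])
  show "((\<lambda>y. of_int y / (2 * \<i>) * exp (\<i> * of_int y * of_real \<theta>)) has_sum of_real (sin \<theta>)) {1, -1}" for \<theta>
  proof (rule has_sum_finiteI)
    show "of_real (sin \<theta>) = (\<Sum>y\<in>{1, -1}. of_int y / (2 * \<i>) * exp (\<i> * of_int y * of_real \<theta>))"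
      by (simp add: sin_of_real[symmetric] sin_exp_eq field_simps)
  qed simp
qed simp

text \<open>Expanding \<open>cos\<^sup>n \<theta> = 2\<^sup>-\<^sup>n (e\<^sup>i\<^sup>\<theta> + e\<^sup>-\<^sup>i\<^sup>\<theta>)\<^sup>n\<close> by the binomial theorem gives coefficients of total
  mass one for each \<open>n\<close>, hence a double series of total mass \<open>\<Sum>n. \<bar>a\<^sub>n\<bar>\<close>.\<close>

lemma wiener_power_series_cos:
  fixes a :: "nat \<Rightarrow> complex"
  assumes a: "summable (\<lambda>n. norm (a n))"
    and f: "\<And>\<theta>. (\<lambda>n. a n * of_real (cos \<theta>) ^ n) sums f \<theta>"
  shows "wiener f"
proof (rule wienerI)
  let ?A = "Sigma UNIV (\<lambda>n::nat. {..n})"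
  let ?c = "\<lambda>(n, k). a n * of_nat (n choose k) / 2 ^ n"
  let ?m = "\<lambda>(n, k). 2 * int k - int n"
  have "(\<lambda>(n, k). norm (a n) * (of_nat (n choose k) / 2 ^ n)) summable_on ?A"
  proof (rule summable_on_SigmaI)
    show "((\<lambda>k. (\<lambda>(n, k). norm (a n) * (of_nat (n choose k) / 2 ^ n)) (n, k)) has_sum norm (a n)) {..n}" for n
    proof (rule has_sum_finiteI)
      have "(\<Sum>k\<le>n. real (n choose k)) = 2 ^ n"
        using choose_row_sum[of n] by (metis of_nat_numeral of_nat_power of_nat_sum)
      then show "norm (a n) = (\<Sum>k\<in>{..n}. (\<lambda>(n, k). norm (a n) * (of_nat (n choose k) / 2 ^ n)) (n, k))"
        by (simp add: sum_distrib_left[symmetric] sum_divide_distrib[symmetric])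
    qed simp
    show "(\<lambda>n. norm (a n)) summable_on UNIV"
      using a by (intro norm_summable_imp_summable_on) simp
  qed auto
  then show c: "(\<lambda>p. norm (?c p)) summable_on ?A"
    by (simp add: case_prod_unfold norm_mult norm_divide norm_power)
  fix \<theta>
  have pow: "(\<Sum>k\<le>n. of_nat (n choose k) / 2 ^ n * exp (\<i> * of_int (2 * int k - int n) * of_real \<theta>))
               = of_real (cos \<theta>) ^ n" for n
  proof -
    have "of_real (cos \<theta>) ^ n = ((exp (\<i> * of_real \<theta>) + exp (- (\<i> * of_real \<theta>))) / 2) ^ n"
      by (simp add: cos_of_real[symmetric] cos_exp_eq)
    also have "\<dots> = (\<Sum>k\<le>n. of_nat (n choose k) / 2 ^ n * (exp (\<i> * of_real \<theta>) ^ k * exp (- (\<i> * of_real \<theta>)) ^ (n - k)))"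
      by (simp add: power_divide binomial_ring sum_divide_distrib mult_ac)
    also have "\<dots> = (\<Sum>k\<le>n. of_nat (n choose k) / 2 ^ n * exp (\<i> * of_int (2 * int k - int n) * of_real \<theta>))"
      by (intro sum.cong refl)
         (auto simp: exp_of_nat_mult[symmetric] exp_add[symmetric] of_nat_diff algebra_simps)
    finally show ?thesis by simp
  qed
  show "((\<lambda>i. ?c i * exp (\<i> * of_int (?m i) * of_real \<theta>)) has_sum f \<theta>) ?A"
  proof (rule has_sum_SigmaI)
    show "((\<lambda>k. ?c (n, k) * exp (\<i> * of_int (?m (n, k)) * of_real \<theta>)) has_sum a n * of_real (cos \<theta>) ^ n) {..n}" for n
      by (rule has_sum_finiteI) (simp_all add: pow[symmetric] sum_distrib_left mult_ac)
    show "((\<lambda>n. a n * of_real (cos \<theta>) ^ n) has_sum f \<theta>) UNIV"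
    proof (rule norm_summable_imp_has_sum[OF _ f])
      show "summable (\<lambda>n. norm (a n * of_real (cos \<theta>) ^ n))"
        by (rule summable_comparison_test'[OF a, of 0])
           (simp add: norm_mult norm_power mult_left_le power_le_one)
    qed
    show "(\<lambda>i. ?c i * exp (\<i> * of_int (?m i) * of_real \<theta>)) summable_on ?A"
    proof (rule abs_summable_summable)
      show "(\<lambda>i. norm (?c i * exp (\<i> * of_int (?m i) * of_real \<theta>))) summable_on ?A"
        using c by (simp add: norm_mult)
    qed
  qed
qed

lemma abs_mult_cos_less_1:
  fixes s :: real
  assumes "0 \<le> s" "s < 1"
  shows "\<bar>s * cos \<theta>\<bar> < 1"
proof -
  have "\<bar>s * cos \<theta>\<bar> \<le> s"
    using assms by (simp add: abs_mult mult_left_le)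
  then show ?thesis using assms by simp
qed

lemma wiener_holomorphic_cos:
  assumes h: "h holomorphic_on ball 0 1" and s: "0 \<le> s" "s < 1"
  shows "wiener (\<lambda>\<theta>. h (of_real (s * cos \<theta>)))"
proof -
  define a where "a n = (deriv ^^ n) h 0 / fact n" for n
  have a: "(\<lambda>n. a n * z ^ n) sums h z" if "norm z < 1" for z
    using holomorphic_power_series[OF h, of z] that by (simp add: a_def)
  show ?thesis
  proof (rule wiener_power_series_cos)
    \<comment> \<open>A radius strictly between \<open>s\<close> and 1 turns convergence into absolute convergence at \<open>s\<close>.\<close>
    have "norm (of_real ((1 + s) / 2) :: complex) < 1"
      using s by (simp del: of_real_add of_real_divide)
    from sums_summable[OF a[OF this]]
    show "summable (\<lambda>n. norm (a n * of_real s ^ n))"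
      by (rule powser_insidea) (use s in \<open>simp del: of_real_add of_real_divide\<close>)
    show "(\<lambda>n. a n * of_real s ^ n * of_real (cos \<theta>) ^ n) sums h (of_real (s * cos \<theta>))" for \<theta>
    proof -
      have "norm (of_real (s * cos \<theta>) :: complex) < 1"
        using abs_mult_cos_less_1[OF s] by (simp del: of_real_mult)
      from a[OF this] show ?thesis by (simp add: power_mult_distrib mult_ac)
    qed
  qed
qed

section \<open>The coefficients \<open>I\<close> and \<open>J\<close>\<close>

lemma wiener_phase_quotient:
  assumes s: "0 \<le> s" "s < 1"
  shows "wiener (\<lambda>\<theta>. of_real (phase s \<theta> / sin (phase s \<theta>)))"
proof -
  define h where "h z = Arccos z / csqrt (1 - z\<^sup>2)" for z
  have "h holomorphic_on ball 0 1"
    unfolding h_def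
  proof (intro holomorphic_intros holomorphic_on_Arccos)
    fix z :: complex assume z: "z \<in> ball 0 1"
    then have "\<bar>Re z\<bar> < 1" using abs_Re_le_cmod[of z] by simp
    then show "\<bar>Re z\<bar> < 1" "1 - z\<^sup>2 \<notin> \<real>\<^sub>\<le>\<^sub>0"
      by (auto intro!: one_minus_z2_notin_nonpos_Reals)
    then show "csqrt (1 - z\<^sup>2) \<noteq> 0" by auto
  qed
  note wiener = wiener_holomorphic_cos[OF this s]
  have "h (of_real (s * cos \<theta>)) = of_real (phase s \<theta> / sin (phase s \<theta>))" for \<theta>
  proof -
    let ?x = "s * cos \<theta>"
    have x: "\<bar>?x\<bar> < 1" by (rule abs_mult_cos_less_1[OF s])
    then have "?x\<^sup>2 \<le> 1" by (simp add: abs_square_le_1)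
    then have "csqrt (1 - (of_real ?x)\<^sup>2) = of_real (sqrt (1 - ?x\<^sup>2))"
      using of_real_sqrt[of "1 - ?x\<^sup>2"] by simp
    then show ?thesis
      using x by (simp add: h_def phase_def of_real_arccos sin_arccos_abs del: of_real_mult)
  qed
  with wiener show ?thesis by (simp only:)
qed

text \<open>This is \<open>sin\<^sup>2 \<phi>\<^sub>s = r\<^sup>2 + s\<^sup>2 sin\<^sup>2 \<theta>\<close>, multiplied by \<open>(\<phi>\<^sub>s / sin \<phi>\<^sub>s)\<^sup>2\<close>.\<close>

lemma phase_square:
  assumes s: "0 \<le> s" "s < 1" and r: "s\<^sup>2 + r\<^sup>2 = 1"
  shows "(phase s \<theta>)\<^sup>2 = s\<^sup>2 * (sin \<theta> * (phase s \<theta> / sin (phase s \<theta>)))\<^sup>2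
           + r\<^sup>2 * (phase s \<theta> / sin (phase s \<theta>))\<^sup>2"
proof -
  let ?x = "s * cos \<theta>"
  have "\<bar>?x\<bar> < 1" by (rule abs_mult_cos_less_1[OF s])
  then have x: "?x\<^sup>2 < 1" by (simp add: abs_square_less_1)
  have "(sin (phase s \<theta>))\<^sup>2 = 1 - ?x\<^sup>2"
    using \<open>\<bar>?x\<bar> < 1\<close> x by (simp add: phase_def sin_arccos_abs)
  also have "\<dots> = s\<^sup>2 * (sin \<theta>)\<^sup>2 + r\<^sup>2"
    using r by (simp add: power_mult_distrib sin_squared_eq algebra_simps)
  finally have "s\<^sup>2 * (sin \<theta>)\<^sup>2 + r\<^sup>2 = (sin (phase s \<theta>))\<^sup>2" ..
  moreover have "sin (phase s \<theta>) \<noteq> 0"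
    using \<open>(sin (phase s \<theta>))\<^sup>2 = 1 - ?x\<^sup>2\<close> x by auto
  ultimately have "(phase s \<theta>)\<^sup>2 = (s\<^sup>2 * (sin \<theta>)\<^sup>2 + r\<^sup>2) * (phase s \<theta> / sin (phase s \<theta>))\<^sup>2"
    by (simp add: power_divide)
  then show ?thesis
    by (simp only: power_mult_distrib distrib_right mult.assoc)
qed

lemma wiener_sin_phase_quotient:
  assumes "0 \<le> s" "s < 1"
  shows "wiener (\<lambda>\<theta>. of_real (sin \<theta> * (phase s \<theta> / sin (phase s \<theta>))))"
  using wiener_mult(1)[OF wiener_sin wiener_phase_quotient[OF assms]] by (simp only: of_real_mult)

lemma summable_coeff:
  assumes "0 \<le> s" "s < 1"
  shows "(\<lambda>y. norm (I_coeff s y)) summable_on UNIV" "(\<lambda>y. norm (J_coeff s y)) summable_on UNIV"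
  using wiener_sin_phase_quotient[OF assms] wiener_phase_quotient[OF assms]
  unfolding wiener_def I_coeff_def J_coeff_def by blast+

text \<open>Here \<open>u\<close>, \<open>v\<close> and \<open>k\<close> are the Fourier coefficients of \<open>p\<^sup>2\<close>, \<open>q\<^sup>2\<close> and \<open>p q\<close>, where
  \<open>q = \<phi>\<^sub>s / sin \<phi>\<^sub>s\<close> and \<open>p = sin \<theta> q\<close>.\<close>

lemma coeff_convolutions:
  assumes s: "0 \<le> s" "s < 1" and r: "s\<^sup>2 + r\<^sup>2 = 1"
  obtains u v k where
    "\<And>w. ((\<lambda>y. I_coeff s y * I_coeff s (w - y)) has_sum u w) UNIV"
    "\<And>w. ((\<lambda>y. J_coeff s y * J_coeff s (w - y)) has_sum v w) UNIV"
    "\<And>w. ((\<lambda>y. I_coeff s y * J_coeff s (w - y)) has_sum k w) UNIV"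
    "\<And>w. ((\<lambda>y. J_coeff s y * I_coeff s (w - y)) has_sum k w) UNIV"
    "\<And>w. fourier (\<lambda>\<theta>. of_real ((phase s \<theta>)\<^sup>2)) w = of_real (s\<^sup>2) * u w + of_real (r\<^sup>2) * v w"
proof -
  define q :: "real \<Rightarrow> complex" where "q \<theta> = of_real (phase s \<theta> / sin (phase s \<theta>))" for \<theta>
  define p :: "real \<Rightarrow> complex" where "p \<theta> = of_real (sin \<theta> * (phase s \<theta> / sin (phase s \<theta>)))" for \<theta>
  have IJ: "I_coeff s = fourier p" "J_coeff s = fourier q"
    unfolding I_coeff_def J_coeff_def p_def q_def by (rule refl)+
  have q: "wiener q"
    unfolding q_def by (rule wiener_phase_quotient[OF s])
  have p: "wiener p"
    unfolding p_def by (rule wiener_sin_phase_quotient[OF s])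
  have "(\<lambda>\<theta>. of_real ((phase s \<theta>)\<^sup>2)) = (\<lambda>\<theta>. of_real (s\<^sup>2) * (p \<theta> * p \<theta>) + of_real (r\<^sup>2) * (q \<theta> * q \<theta>))"
  proof
    fix \<theta>
    show "of_real ((phase s \<theta>)\<^sup>2) = of_real (s\<^sup>2) * (p \<theta> * p \<theta>) + of_real (r\<^sup>2) * (q \<theta> * q \<theta>)"
      by (subst phase_square[OF assms]) (simp add: p_def q_def power2_eq_square)
  qed
  then have "fourier (\<lambda>\<theta>. of_real ((phase s \<theta>)\<^sup>2)) w
      = of_real (s\<^sup>2) * fourier (\<lambda>\<theta>. p \<theta> * p \<theta>) w + of_real (r\<^sup>2) * fourier (\<lambda>\<theta>. q \<theta> * q \<theta>) w" for w
    by (simp only: fourier_combination[OF wiener_mult(1)[OF p p] wiener_mult(1)[OF q q]])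
  moreover have "((\<lambda>y. fourier q y * fourier p (w - y)) has_sum fourier (\<lambda>\<theta>. p \<theta> * q \<theta>) w) UNIV" for w
    using wiener_mult(2)[OF q p, of w] by (simp add: mult.commute)
  ultimately show thesis
    using that[of "fourier (\<lambda>\<theta>. p \<theta> * p \<theta>)" "fourier (\<lambda>\<theta>. q \<theta> * q \<theta>)" "fourier (\<lambda>\<theta>. p \<theta> * q \<theta>)"]
      wiener_mult(2)[OF p p] wiener_mult(2)[OF q q] wiener_mult(2)[OF p q]
    unfolding IJ by blast
qed

section \<open>Products of operators with matrix coefficients\<close>

instance l2 :: banach ..

lemma bounded_linear_matrix_op: "bounded_linear matrix_op"
proof -
  have "linear matrix_op"
    by (intro linearI blinfun_eqI l2_eqI)
       (simp_all add: matrix_op_apply plus_blinfun.rep_eq scaleR_blinfun.rep_eq plus_l2.rep_eq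
         scaleR_l2.rep_eq vec_eq_iff matrix_vector_mult_def distrib_right sum.distrib scaleR_sum_right)
  then show ?thesis by (simp add: linear_conv_bounded_linear)
qed

lemma norm_shift_power_le: "norm (shift_power y) \<le> 1"
proof (rule norm_blinfun_bound)
  fix f
  have "(norm (shift_power y f))\<^sup>2 = (norm f)\<^sup>2"
    using infsum_reindex_bij_betw[of "\<lambda>x. x - y" UNIV UNIV "\<lambda>x. (norm (l2_apply f x))\<^sup>2"]
    by (simp add: norm_l2_square shift_power_apply bij_diff_right)
  then show "norm (shift_power y f) \<le> 1 * norm f" by simp
qed simp

lemma matrix_shift_compose:
  "(matrix_op A o\<^sub>L shift_power y) o\<^sub>L (matrix_op B o\<^sub>L shift_power z)
     = matrix_op (A ** B) o\<^sub>L shift_power (y + z)"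
  by (intro blinfun_eqI l2_eqI)
     (simp add: matrix_op_apply shift_power_apply matrix_vector_mul_assoc algebra_simps)

lemma summable_matrix_shift:
  fixes M :: "int \<Rightarrow> complex^2^2"
  assumes "(\<lambda>y. norm (M y)) summable_on UNIV"
  shows "(\<lambda>y. norm (matrix_op (M y) o\<^sub>L shift_power y)) summable_on UNIV"
proof -
  obtain K where K: "\<And>A. norm (matrix_op A) \<le> norm A * K"
    using bounded_linear.bounded[OF bounded_linear_matrix_op] by blast
  show ?thesis
  proof (rule Infinite_Sum.abs_summable_on_comparison_test')
    show "(\<lambda>y. norm (M y) * K) summable_on UNIV"
      using assms by (rule summable_on_cmult_left)
    fix y
    have "norm (matrix_op (M y) o\<^sub>L shift_power y) \<le> norm (matrix_op (M y)) * norm (shift_power y)"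
      by (rule norm_blinfun_compose)
    also have "\<dots> \<le> norm (matrix_op (M y))"
      using norm_shift_power_le by (simp add: mult_left_le)
    also have "\<dots> \<le> norm (M y) * K" by (rule K)
    finally show "norm (matrix_op (M y) o\<^sub>L shift_power y) \<le> norm (M y) * K" .
  qed
qed

text \<open>Constant matrices commute with shifts, so the product of two such series has the terms
  \<open>M\<^sub>y N\<^sub>z \<tau>\<^sup>y\<^sup>+\<^sup>z\<close>; absolute convergence allows them to be grouped by the value of \<open>y + z\<close>.\<close>

lemma has_sum_matrix_shift_compose:
  fixes M N P :: "int \<Rightarrow> complex^2^2"
  assumes M: "(\<lambda>y. norm (M y)) summable_on UNIV" and N: "(\<lambda>y. norm (N y)) summable_on UNIV"
    and P: "\<And>w. ((\<lambda>y. M y ** N (w - y)) has_sum P w) UNIV"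
  shows "((\<lambda>w. matrix_op (P w) o\<^sub>L shift_power w) has_sum
           ((\<Sum>\<^sub>\<infinity>y. matrix_op (M y) o\<^sub>L shift_power y) o\<^sub>L (\<Sum>\<^sub>\<infinity>y. matrix_op (N y) o\<^sub>L shift_power y))) UNIV"
proof (rule has_sum_antidiagonals)
  show "((\<lambda>(y, z). (matrix_op (M y) o\<^sub>L shift_power y) o\<^sub>L (matrix_op (N z) o\<^sub>L shift_power z)) has_sum
           ((\<Sum>\<^sub>\<infinity>y. matrix_op (M y) o\<^sub>L shift_power y) o\<^sub>L (\<Sum>\<^sub>\<infinity>y. matrix_op (N y) o\<^sub>L shift_power y))) UNIV"
    using has_sum_bilinear_product(2)[OF bounded_bilinear_blinfun_compose
        summable_matrix_shift[OF M] summable_matrix_shift[OF N]] by simp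
  have "bounded_linear (\<lambda>A. matrix_op A o\<^sub>L shift_power w)" for w
    by (intro bounded_linear_compose[OF _ bounded_linear_matrix_op]
        bounded_bilinear.bounded_linear_left[OF bounded_bilinear_blinfun_compose])
  from has_sum_bounded_linear[OF this P]
  show "((\<lambda>y. (matrix_op (M y) o\<^sub>L shift_power y) o\<^sub>L (matrix_op (N (w - y)) o\<^sub>L shift_power (w - y))) has_sum
           (matrix_op (P w) o\<^sub>L shift_power w)) UNIV" for w
    by (simp add: matrix_shift_compose)
qed

lemma has_sum_matrixI:
  fixes M :: "'i \<Rightarrow> 'a::{comm_monoid_add,topological_space}^'n^'m"
  assumes "\<And>i j. ((\<lambda>y. M y $ i $ j) has_sum S $ i $ j) A"
  shows "(M has_sum S) A"
  using assms unfolding has_sum_def by (auto intro!: vec_tendstoI simp: sum_component)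

lemma summable_on_finite_sum:
  fixes f :: "'i \<Rightarrow> 'j \<Rightarrow> 'a::{topological_comm_monoid_add}"
  assumes "\<And>i. i \<in> I \<Longrightarrow> f i summable_on A"
  shows "(\<lambda>y. \<Sum>i\<in>I. f i y) summable_on A"
  using assms by (induction I rule: infinite_finite_induct) (auto intro: summable_on_add)

lemma summable_matrixI:
  fixes M :: "'i \<Rightarrow> 'a::real_normed_vector^'n^'m"
  assumes "\<And>i j. (\<lambda>y. norm (M y $ i $ j)) summable_on A"
  shows "(\<lambda>y. norm (M y)) summable_on A"
proof (rule Infinite_Sum.abs_summable_on_comparison_test')
  show "(\<lambda>y. \<Sum>i\<in>UNIV. \<Sum>j\<in>UNIV. norm (M y $ i $ j)) summable_on A"
    by (intro summable_on_finite_sum assms)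
  show "norm (M y) \<le> (\<Sum>i\<in>UNIV. \<Sum>j\<in>UNIV. norm (M y $ i $ j))" for y
    unfolding norm_vec_def
    by (rule order_trans[OF L2_set_le_sum]) (auto intro!: sum_mono L2_set_le_sum)
qed

section \<open>The square of the operator\<close>

lemma D_symbol_entries:
  assumes "T = vector [vector [a, b], vector [- cnj b, cnj a]]"
    and "\<alpha> = a / of_real (cmod a)" and "\<beta> = b / of_real (cmod b)"
  shows "D_symbol T x $ 1 $ 1 = of_real (cmod a) * \<alpha> powi x * I_coeff (cmod a) x"
    and "D_symbol T x $ 1 $ 2 = - \<i> * of_real (cmod b) * \<alpha> powi (x + 1) * \<beta> * J_coeff (cmod a) (x + 1)"
    and "D_symbol T x $ 2 $ 1 = \<i> * of_real (cmod b) * \<alpha> powi (x - 1) * inverse \<beta> * J_coeff (cmod a) (x - 1)"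
    and "D_symbol T x $ 2 $ 2 = - of_real (cmod a) * \<alpha> powi x * I_coeff (cmod a) x"
  using assms by (simp_all add: D_symbol_def Let_def vector_2)

lemma summable_D_symbol:
  assumes T: "T = vector [vector [a, b], vector [- cnj b, cnj a]]" and ab: "a \<noteq> 0" "b \<noteq> 0"
    and I: "(\<lambda>y. norm (I_coeff (cmod a) y)) summable_on UNIV"
    and J: "(\<lambda>y. norm (J_coeff (cmod a) y)) summable_on UNIV"
  shows "(\<lambda>y. norm (D_symbol T y)) summable_on UNIV"
proof (rule summable_matrixI)
  define \<alpha> where "\<alpha> = a / of_real (cmod a)"
  define \<beta> where "\<beta> = b / of_real (cmod b)"
  have norm: "norm \<alpha> = 1" "norm \<beta> = 1"
    using ab by (simp_all add: \<alpha>_def \<beta>_def norm_divide)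
  have J': "(\<lambda>y. norm (J_coeff (cmod a) (y + k))) summable_on UNIV" for k
    using J summable_on_reindex_bij_betw[of "\<lambda>y. y + k" UNIV UNIV "\<lambda>y. norm (J_coeff (cmod a) y)"]
    by (simp add: bij_plus_right)
  have "(\<lambda>y. norm (J_coeff (cmod a) (y - 1))) summable_on UNIV"
    using J'[of "-1"] by simp
  then show "(\<lambda>y. norm (D_symbol T y $ i $ j)) summable_on UNIV" for i j
    using I J'[of 1] exhaust_2[of i] exhaust_2[of j]
    by (auto simp: D_symbol_entries[OF T \<alpha>_def \<beta>_def] norm_mult norm_power_int norm_inverse norm
        intro!: summable_on_cmult_right)
qed

text \<open>The factors \<open>\<beta>\<close> and \<open>1 / \<beta>\<close> cancel on the diagonal, and \<open>(- \<i>) \<i> = 1\<close> makes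
  both contributions there positive. Off the diagonal the opposite signs of the two diagonal
  coefficients turn the product into a commutator of \<open>I\<close> and \<open>J\<close>, up to a shift of the index
  by one.\<close>

lemma D_symbol_product_entries:
  assumes T: "T = vector [vector [a, b], vector [- cnj b, cnj a]]" and ab: "a \<noteq> 0" "b \<noteq> 0"
    and \<alpha>: "\<alpha> = a / of_real (cmod a)" and \<beta>: "\<beta> = b / of_real (cmod b)"
    and s: "s = of_real (cmod a)" and r: "r = of_real (cmod b)"
    and I: "I = I_coeff (cmod a)" and J: "J = J_coeff (cmod a)"
  shows "(D_symbol T y ** D_symbol T (w - y)) $ 1 $ 1
           = \<alpha> powi w * (s\<^sup>2 * (I y * I (w - y)) + r\<^sup>2 * (J (y + 1) * J (w - y - 1)))"
    and "(D_symbol T y ** D_symbol T (w - y)) $ 2 $ 2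
           = \<alpha> powi w * (s\<^sup>2 * (I y * I (w - y)) + r\<^sup>2 * (J (y - 1) * J (w - y + 1)))"
    and "(D_symbol T y ** D_symbol T (w - y)) $ 1 $ 2
           = - \<i> * s * r * \<beta> * \<alpha> powi (w + 1) * (I y * J (w - y + 1) - J (y + 1) * I (w - y))"
    and "(D_symbol T y ** D_symbol T (w - y)) $ 2 $ 1
           = - \<i> * s * r * inverse \<beta> * \<alpha> powi (w - 1) * (I y * J (w - y - 1) - J (y - 1) * I (w - y))"
proof -
  note entries = D_symbol_entries[OF T \<alpha> \<beta>, folded s r I J]
  have nz: "\<alpha> \<noteq> 0" "\<beta> * inverse \<beta> = 1" using ab by (simp_all add: \<alpha> \<beta>)
  have \<alpha>_add: "\<alpha> powi m * \<alpha> powi n = \<alpha> powi (m + n)" for m n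
    using nz by (simp add: power_int_add)
  have product: "(D_symbol T y ** D_symbol T (w - y)) $ i $ j
      = D_symbol T y $ i $ 1 * D_symbol T (w - y) $ 1 $ j + D_symbol T y $ i $ 2 * D_symbol T (w - y) $ 2 $ j" for i j
    by (simp add: matrix_matrix_mult_def sum_2)
  (* The four entries as polynomial identities: the powers of \<alpha> enter through their products only. *)
  have ring11: "s * x * i1 * (s * x' * i2) + - \<i> * r * z * d * j1 * (\<i> * r * z' * d' * j2)
      = c * (s\<^sup>2 * (i1 * i2) + r\<^sup>2 * (j1 * j2))"
    if "x * x' = c" "z * z' = c" "d * d' = 1" for x x' z z' d d' c i1 i2 j1 j2 :: complex
  proof -
    have "s * x * i1 * (s * x' * i2) + - \<i> * r * z * d * j1 * (\<i> * r * z' * d' * j2)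
        = (x * x') * (s * s * (i1 * i2)) - (\<i> * \<i>) * (z * z') * (d * d') * (r * r * (j1 * j2))"
      by (simp only: mult_ac mult_minus_left mult_minus_right diff_conv_add_uminus)
    then show ?thesis using that by (simp add: power2_eq_square distrib_left)
  qed
  have ring22: "\<i> * r * z * d * j1 * (- \<i> * r * z' * d' * j2) + - s * x * i1 * (- s * x' * i2)
      = c * (s\<^sup>2 * (i1 * i2) + r\<^sup>2 * (j1 * j2))"
    if "x * x' = c" "z * z' = c" "d' * d = 1" for x x' z z' d d' c i1 i2 j1 j2 :: complex
    using ring11[of x x' c z z' d d' i1 i2 j1 j2] that by (simp add: mult_ac add_ac)
  have ring12: "s * x * i1 * (- \<i> * r * z' * d * j2) + - \<i> * r * z * d * j1 * (- s * x' * i2)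
      = - \<i> * s * r * d * c * (i1 * j2 - j1 * i2)"
    if "x * z' = c" "z * x' = c" for x x' z z' d c i1 i2 j1 j2 :: complex
  proof -
    have "s * x * i1 * (- \<i> * r * z' * d * j2) + - \<i> * r * z * d * j1 * (- s * x' * i2)
        = - \<i> * s * r * d * ((x * z') * (i1 * j2) - (z * x') * (j1 * i2))"
      by (simp add: algebra_simps)
    then show ?thesis using that by (simp add: right_diff_distrib)
  qed
  have ring21: "\<i> * r * z * d * j1 * (s * x' * i2) + - s * x * i1 * (\<i> * r * z' * d * j2)
      = - \<i> * s * r * d * c * (i1 * j2 - j1 * i2)"
    if "x * z' = c" "z * x' = c" for x x' z z' d c i1 i2 j1 j2 :: complex
    using ring12[of x z' c z x' i1 d j2 j1 i2] that by (simp add: algebra_simps)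
  show "(D_symbol T y ** D_symbol T (w - y)) $ 1 $ 1
      = \<alpha> powi w * (s\<^sup>2 * (I y * I (w - y)) + r\<^sup>2 * (J (y + 1) * J (w - y - 1)))"
    unfolding product entries by (rule ring11[OF _ _ nz(2)]) (simp_all add: \<alpha>_add)
  show "(D_symbol T y ** D_symbol T (w - y)) $ 2 $ 2
      = \<alpha> powi w * (s\<^sup>2 * (I y * I (w - y)) + r\<^sup>2 * (J (y - 1) * J (w - y + 1)))"
    unfolding product entries by (rule ring22[OF _ _ nz(2)]) (simp_all add: \<alpha>_add)
  show "(D_symbol T y ** D_symbol T (w - y)) $ 1 $ 2
      = - \<i> * s * r * \<beta> * \<alpha> powi (w + 1) * (I y * J (w - y + 1) - J (y + 1) * I (w - y))"
    unfolding product entries by (rule ring12) (simp_all add: \<alpha>_add algebra_simps)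
  show "(D_symbol T y ** D_symbol T (w - y)) $ 2 $ 1
      = - \<i> * s * r * inverse \<beta> * \<alpha> powi (w - 1) * (I y * J (w - y - 1) - J (y - 1) * I (w - y))"
    unfolding product entries by (rule ring21) (simp_all add: \<alpha>_add algebra_simps)
qed

text \<open>The common limit \<open>k\<close> of the two mixed convolutions expresses that \<open>I\<close> and \<open>J\<close> commute under convolution;
  it removes the off-diagonal entries.\<close>

lemma has_sum_D_symbol_square:
  assumes T: "T = vector [vector [a, b], vector [- cnj b, cnj a]]" and ab: "a \<noteq> 0" "b \<noteq> 0"
    and \<alpha>: "\<alpha> = a / of_real (cmod a)"
    and II: "\<And>w. ((\<lambda>y. I_coeff (cmod a) y * I_coeff (cmod a) (w - y)) has_sum u w) UNIV"
    and JJ: "\<And>w. ((\<lambda>y. J_coeff (cmod a) y * J_coeff (cmod a) (w - y)) has_sum v w) UNIV"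
    and IJ: "\<And>w. ((\<lambda>y. I_coeff (cmod a) y * J_coeff (cmod a) (w - y)) has_sum k w) UNIV"
    and JI: "\<And>w. ((\<lambda>y. J_coeff (cmod a) y * I_coeff (cmod a) (w - y)) has_sum k w) UNIV"
  shows "((\<lambda>y. D_symbol T y ** D_symbol T (w - y)) has_sum
           mat (\<alpha> powi w * (of_real ((cmod a)\<^sup>2) * u w + of_real ((cmod b)\<^sup>2) * v w))) UNIV"
proof (rule has_sum_matrixI)
  define \<beta> where "\<beta> = b / of_real (cmod b)"
  define s r :: complex where "s = of_real (cmod a)" and "r = of_real (cmod b)"
  let ?I = "I_coeff (cmod a)" and ?J = "J_coeff (cmod a)"
  note entries = D_symbol_product_entries[OF T ab \<alpha> \<beta>_def s_def r_def refl refl]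
  have shift: "((\<lambda>y. g (y + j)) has_sum S) UNIV \<longleftrightarrow> (g has_sum S) UNIV"
    for g :: "int \<Rightarrow> complex" and S and j
    by (rule has_sum_reindex_bij_witness[where i = "\<lambda>y. y - j" and j = "\<lambda>y. y + j"]) auto
  have JJ': "((\<lambda>y. ?J (y + j) * ?J (w - y - j)) has_sum v w) UNIV" for j
    using JJ[of w] shift[of "\<lambda>y. ?J y * ?J (w - y)" j "v w"] by (simp add: algebra_simps)
  have JI': "((\<lambda>y. ?J (y + j) * ?I (w - y)) has_sum k (w + j)) UNIV" for j
    using JI[of "w + j"] shift[of "\<lambda>y. ?J y * ?I (w + j - y)" j "k (w + j)"] by (simp add: algebra_simps)
  have diag: "((\<lambda>y. \<alpha> powi w * (s\<^sup>2 * (?I y * ?I (w - y)) + r\<^sup>2 * (?J (y + j) * ?J (w - y - j))))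
      has_sum \<alpha> powi w * (s\<^sup>2 * u w + r\<^sup>2 * v w)) UNIV" for j
    by (intro has_sum_cmult_right has_sum_add II JJ')
  have off: "((\<lambda>y. C * (?I y * ?J (w - y + j) - ?J (y + j) * ?I (w - y))) has_sum 0) UNIV" for C j
  proof -
    have "((\<lambda>y. ?I y * ?J (w - y + j) + - 1 * (?J (y + j) * ?I (w - y))) has_sum k (w + j) + - 1 * k (w + j)) UNIV"
      using IJ[of "w + j"] by (intro has_sum_add has_sum_cmult_right JI') (simp add: algebra_simps)
    from has_sum_cmult_right[OF this, of C] show ?thesis by simp
  qed
  fix i j :: 2
  have s2: "of_real ((cmod a)\<^sup>2) = s\<^sup>2" "of_real ((cmod b)\<^sup>2) = r\<^sup>2"
    by (simp_all add: s_def r_def)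
  show "((\<lambda>y. (D_symbol T y ** D_symbol T (w - y)) $ i $ j) has_sum
      mat (\<alpha> powi w * (of_real ((cmod a)\<^sup>2) * u w + of_real ((cmod b)\<^sup>2) * v w)) $ i $ j) UNIV"
    unfolding s2
    using exhaust_2[of i] exhaust_2[of j] diag[of 1] diag[of "-1"]
      off[of "- \<i> * s * r * \<beta> * \<alpha> powi (w + 1)" 1] off[of "- \<i> * s * r * inverse \<beta> * \<alpha> powi (w - 1)" "-1"]
    by (auto simp: entries mat_def)
qed

theorem mainTheorem4:
  fixes a b \<alpha> :: complex and s :: real and T :: "complex^2^2"
  assumes "T = vector [vector [a, b], vector [- cnj b, cnj a]]"
    and "special_unitary T"
    and "a * b \<noteq> 0"
    and "s = cmod a"
    and "\<alpha> = a / of_real (cmod a)"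
  shows "((\<lambda>y. matrix_op (mat (\<alpha> powi y * fourier (\<lambda>\<theta>. of_real ((phase s \<theta>)\<^sup>2)) y)) o\<^sub>L shift_power y)
           has_sum (D_op T o\<^sub>L D_op T)) UNIV"
proof -
  have ab: "a \<noteq> 0" "b \<noteq> 0" using assms(3) by auto
  have "a * cnj a + b * cnj b = 1"
    using assms(1,2) by (simp add: special_unitary_def det_2 vector_2)
  then have "of_real ((cmod a)\<^sup>2 + (cmod b)\<^sup>2) = (1 :: complex)"
    by (simp only: of_real_add complex_norm_square)
  then have sr: "s\<^sup>2 + (cmod b)\<^sup>2 = 1"
    using assms(4) by (simp only: of_real_eq_1_iff)
  moreover have "(cmod b)\<^sup>2 > 0" using ab by simp
  ultimately have "s\<^sup>2 < 1\<^sup>2" unfolding one_power2 by linarith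
  then have s: "0 \<le> s" "s < 1"
    using assms(4) by (auto intro: power2_less_imp_less)
  obtain u v k where
    "\<And>w. ((\<lambda>y. I_coeff s y * I_coeff s (w - y)) has_sum u w) UNIV"
    "\<And>w. ((\<lambda>y. J_coeff s y * J_coeff s (w - y)) has_sum v w) UNIV"
    "\<And>w. ((\<lambda>y. I_coeff s y * J_coeff s (w - y)) has_sum k w) UNIV"
    "\<And>w. ((\<lambda>y. J_coeff s y * I_coeff s (w - y)) has_sum k w) UNIV"
    and F: "\<And>w. fourier (\<lambda>\<theta>. of_real ((phase s \<theta>)\<^sup>2)) w = of_real (s\<^sup>2) * u w + of_real ((cmod b)\<^sup>2) * v w"
    using coeff_convolutions[OF s sr] by blast
  note square = has_sum_D_symbol_square[OF assms(1) ab assms(5) this(1-4)[unfolded assms(4)]]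
  have summable: "(\<lambda>y. norm (D_symbol T y)) summable_on UNIV"
    using summable_D_symbol[OF assms(1) ab] summable_coeff[OF s] assms(4) by simp
  show ?thesis
    unfolding D_op_def F using has_sum_matrix_shift_compose[OF summable summable square] assms(4) by simp
qed

end
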